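(* Let $\mathbf{Q}$ be a set of qubits, $\mathbf{G}$ a set of gates (each gate $G\in\mathbf{G}$ having a duration $d_G\in\mathbb{R}_{\ge 0}$ and a tuple $(q_1,\dots,q_n)$ of distinct qubits it acts on), and $\mathbf{C}$ a set of channels. Let $\mathcal{S}$ be the symmetric monoidal category of signals over $\mathbf{C}$. Assume given a correspondence between channels and qubits (in the simplest case this could be an injection $\mathbf{Q}\to\mathbf{C}$), giving the objects $X_q$ of $\mathcal{S}$ for $q\in\mathbf{Q}$, and a pulse representation of each gate in $\mathbf{G}$, giving the morphisms $f_G$. Then $\mathcal{S}$ can be extended to a categorical model of the annotated language as follows: - For every real number $x\in\mathbb{R}$, the functor $\mathrm{Shift}(x)$ is defined by $$\mathrm{Shift}(x)[(t_1,c_1),\dots,(t_n,c_n)]:=[(t_1+x,c_1),\dots,(t_n+x,c_n)],$$ $$\mathrm{Shift}(x)(\sigma,[\phi_1,\dots,\phi_n]):=(\sigma,[\phi_1(\cdot-x),\dots,\phi_n(\cdot-x)]).$$ - For every real number $x\in\mathbb{R}$, the morphisms $\mathrm{delay}_x$ are built from the identity permutation $e\in S_1$ and the pulse $\delta_0$ which is constantly zero: $\mathrm{delay}_x=(e,[\delta_0])$.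
   Context: **Categorical model of the annotated language.** Fix $\mathbf{Q}$ and $\mathbf{G}$ as in the claim; write $(G,d,q_1,\dots,q_n)\in\mathbf{G}$ for a gate $G$ of duration $d$ acting on $(q_1,\dots,q_n)$. A categorical model $(\mathcal{C}^\otimes,X_{-},f_{-},\mathrm{Shift}(-),\mathrm{delay}_{-})$ consists of: a symmetric monoidal category (SMC) $\mathcal{C}^\otimes$; for every $q\in\mathbf{Q}$ an object $X_q$ of $\mathcal{C}^\otimes$; a monoidal functor $\mathrm{Shift}(-)$ from the discrete category of real numbers (monoidal under $+$) to the category of symmetric monoidal endofunctors of $\mathcal{C}^\otimes$ (monoidal under composition); for every gate $(G,d,q_1,\dots,q_n)$ a morphism $f_G:\mathrm{Shift}(-d)(\bigotimes_{i=1}^n X_{q_i})\to\bigotimes_{i=1}^n X_{q_i}$; for every real number $x\in\mathbb{R}$ and every $q\in\mathbf{Q}$ a morphism $\mathrm{delay}_x:\mathrm{Shift}(-x)(X_q)\to X_q$. Monoidality here means that there are coherent natural isomorphisms $\mathrm{Shift}(0)(X)\simeq X$, $\mathrm{Shift}(d_1+d_2)(X)\simeq\mathrm{Shift}(d_1)(\mathrm{Shift}(d_2)(X))$, $\mathrm{Shift}(d)(I)\simeq I$, $\mathrm{Shift}(d)(X\otimes Y)\simeq\mathrm{Shift}(d)(X)\otimes\mathrm{Shift}(d)(Y)$. **The SMC of signals $\mathcal{S}$.** - Objects: finite sequences of elements of $\mathbb{R}\times\mathbf{C}$ (a starting time and a channel). - Morphisms from $X=[(s_1,c_1),\dots,(s_m,c_m)]$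 to $Y=[(t_1,d_1),\dots,(t_n,d_n)]$: none if $m\ne n$; if $m=n$, pairs $(\sigma,[\phi_1,\dots,\phi_n])$ with $\sigma\in S_n$ (the symmetric group) such that for all $k$: $c_k=d_{\sigma(k)}$, $s_k\le t_{\sigma(k)}$, and $\phi_k:[s_k,t_{\sigma(k)})\to\mathbb{R}$ (a pulse; no regularity conditions are imposed). - Identities: the identity permutation with empty functions. - Composition, for $(\sigma_2,[\psi_k])$ from $[(r_k,b_k)]_k$ to $[(s_k,c_k)]_k$ and $(\sigma_1,[\phi_k])$ from $[(s_k,c_k)]_k$ to $[(t_k,d_k)]_k$: $(\sigma_1,[\phi_k])\circ(\sigma_2,[\psi_k]):=(\sigma_1\circ\sigma_2,[\gamma_k])$, where $\gamma_k:[r_k,t_{(\sigma_1\circ\sigma_2)(k)})\to\mathbb{R}$ equals $\psi_k$ on $[r_k,s_{\sigma_2(k)})$ and $\phi_{\sigma_2(k)}$ on $[s_{\sigma_2(k)},t_{(\sigma_1\circ\sigma_2)(k)})$. - Tensor unit: the empty sequence. Tensor of objects: concatenation. Tensor of morphisms: $(\sigma_1,[\phi_1,\dots,\phi_m])\otimes(\sigma_2,[\psi_1,\dots,\psi_n]):=(\sigma_1\star\sigma_2,[\phi_1,\dots,\phi_m,\psi_1,\dots,\psi_n])$, with $\star:S_m\times S_n\to S_{m+n}$ the evident (block-sum) group homomorphism. - Unitors and associators are identities; the symmetry is the appropriate permutation together with empty functions.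
   Formalization: The morphisms delay_x are claimed only for x ≥ 0, not for every real x: for x < 0 there is no morphism Shift(-x)(X_q) → X_q in S when X_q is nonempty, since morphisms require starting times not to decrease. Shift(x) is still given for all real x. *)

theory Defs
  imports Complex_Main "HOL-Library.FuncSet" "HOL-Combinatorics.Permutations"
begin

section \<open>Symmetric monoidal categories\<close>

text \<open>
  The operations are only meaningful on the carriers \<open>Obj\<close> and \<open>Arr\<close>; all laws are relativised
  to these.
\<close>

record ('o, 'm) category =
  Obj :: "'o set"
  Arr :: "'m set"
  Dom :: "'m \<Rightarrow> 'o"
  Cod :: "'m \<Rightarrow> 'o"
  ident :: "'o \<Rightarrow> 'm" ("\<one>\<index>")
  compose :: "'m \<Rightarrow> 'm \<Rightarrow> 'm" (infixr "\<cdot>\<index>" 55)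

definition hom :: "('o, 'm, 'z) category_scheme \<Rightarrow> 'o \<Rightarrow> 'o \<Rightarrow> 'm set" where
  "hom C a b = {f \<in> Arr C. Dom C f = a \<and> Cod C f = b}"

definition iso :: "('o, 'm, 'z) category_scheme \<Rightarrow> 'o \<Rightarrow> 'o \<Rightarrow> 'm set" where
  "iso C a b = {f \<in> hom C a b. \<exists>g \<in> hom C b a.
     compose C g f = ident C a \<and> compose C f g = ident C b}"

locale category =
  fixes C :: "('o, 'm, 'z) category_scheme" (structure)
  assumes Dom_in_Obj: "f \<in> Arr C \<Longrightarrow> Dom C f \<in> Obj C"
    and Cod_in_Obj: "f \<in> Arr C \<Longrightarrow> Cod C f \<in> Obj C"
    and ident_in_hom: "a \<in> Obj C \<Longrightarrow> \<one> a \<in> hom C a a"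
    and comp_in_hom: "f \<in> hom C a b \<Longrightarrow> g \<in> hom C b c \<Longrightarrow> g \<cdot> f \<in> hom C a c"
    and ident_comp: "f \<in> hom C a b \<Longrightarrow> \<one> b \<cdot> f = f"
    and comp_ident: "f \<in> hom C a b \<Longrightarrow> f \<cdot> \<one> a = f"
    and comp_assoc: "f \<in> hom C a b \<Longrightarrow> g \<in> hom C b c \<Longrightarrow> h \<in> hom C c d
      \<Longrightarrow> (h \<cdot> g) \<cdot> f = h \<cdot> (g \<cdot> f)"

record ('o, 'm) smc = "('o, 'm) category" +
  tensor_obj :: "'o \<Rightarrow> 'o \<Rightarrow> 'o" (infixr "\<otimes>\<index>" 70)
  tensor_arr :: "'m \<Rightarrow> 'm \<Rightarrow> 'm" (infixr "\<odot>\<index>" 70)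
  unit_obj :: "'o" ("\<I>\<index>")
  associator :: "'o \<Rightarrow> 'o \<Rightarrow> 'o \<Rightarrow> 'm" ("\<alpha>\<index>")
  left_unitor :: "'o \<Rightarrow> 'm" ("\<l>\<index>")
  right_unitor :: "'o \<Rightarrow> 'm" ("\<r>\<index>")
  symmetry :: "'o \<Rightarrow> 'o \<Rightarrow> 'm" ("\<s>\<index>")

locale symmetric_monoidal_category = category C
  for C :: "('o, 'm, 'z) smc_scheme" (structure) +
  assumes unit_in_Obj: "\<I> \<in> Obj C"
    and tensor_in_Obj: "a \<in> Obj C \<Longrightarrow> b \<in> Obj C \<Longrightarrow> a \<otimes> b \<in> Obj C"
    and tensor_in_hom: "f \<in> hom C a b \<Longrightarrow> g \<in> hom C c d \<Longrightarrow> f \<odot> g \<in> hom C (a \<otimes> c) (b \<otimes> d)"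
    and tensor_ident: "a \<in> Obj C \<Longrightarrow> b \<in> Obj C \<Longrightarrow> \<one> a \<odot> \<one> b = \<one> (a \<otimes> b)"
    and interchange: "f \<in> hom C a b \<Longrightarrow> g \<in> hom C b c \<Longrightarrow> f' \<in> hom C a' b' \<Longrightarrow> g' \<in> hom C b' c'
      \<Longrightarrow> (g \<cdot> f) \<odot> (g' \<cdot> f') = (g \<odot> g') \<cdot> (f \<odot> f')"
    and associator_iso: "a \<in> Obj C \<Longrightarrow> b \<in> Obj C \<Longrightarrow> c \<in> Obj C
      \<Longrightarrow> \<alpha> a b c \<in> iso C ((a \<otimes> b) \<otimes> c) (a \<otimes> (b \<otimes> c))"
    and associator_natural: "f \<in> hom C a a' \<Longrightarrow> g \<in> hom C b b' \<Longrightarrow> h \<in> hom C c c'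
      \<Longrightarrow> \<alpha> a' b' c' \<cdot> ((f \<odot> g) \<odot> h) = (f \<odot> (g \<odot> h)) \<cdot> \<alpha> a b c"
    and left_unitor_iso: "a \<in> Obj C \<Longrightarrow> \<l> a \<in> iso C (\<I> \<otimes> a) a"
    and left_unitor_natural: "f \<in> hom C a b \<Longrightarrow> \<l> b \<cdot> (\<one> \<I> \<odot> f) = f \<cdot> \<l> a"
    and right_unitor_iso: "a \<in> Obj C \<Longrightarrow> \<r> a \<in> iso C (a \<otimes> \<I>) a"
    and right_unitor_natural: "f \<in> hom C a b \<Longrightarrow> \<r> b \<cdot> (f \<odot> \<one> \<I>) = f \<cdot> \<r> a"
    and symmetry_in_hom: "a \<in> Obj C \<Longrightarrow> b \<in> Obj C \<Longrightarrow> \<s> a b \<in> hom C (a \<otimes> b) (b \<otimes> a)"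
    and symmetry_natural: "f \<in> hom C a a' \<Longrightarrow> g \<in> hom C b b'
      \<Longrightarrow> \<s> a' b' \<cdot> (f \<odot> g) = (g \<odot> f) \<cdot> \<s> a b"
    and symmetry_involutive: "a \<in> Obj C \<Longrightarrow> b \<in> Obj C \<Longrightarrow> \<s> b a \<cdot> \<s> a b = \<one> (a \<otimes> b)"
    and triangle: "a \<in> Obj C \<Longrightarrow> b \<in> Obj C \<Longrightarrow> (\<one> a \<odot> \<l> b) \<cdot> \<alpha> a \<I> b = \<r> a \<odot> \<one> b"
    and pentagon: "a \<in> Obj C \<Longrightarrow> b \<in> Obj C \<Longrightarrow> c \<in> Obj C \<Longrightarrow> d \<in> Obj C
      \<Longrightarrow> \<alpha> a b (c \<otimes> d) \<cdot> \<alpha> (a \<otimes> b) c d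
        = (\<one> a \<odot> \<alpha> b c d) \<cdot> \<alpha> a (b \<otimes> c) d \<cdot> (\<alpha> a b c \<odot> \<one> d)"
    and hexagon: "a \<in> Obj C \<Longrightarrow> b \<in> Obj C \<Longrightarrow> c \<in> Obj C
      \<Longrightarrow> \<alpha> b c a \<cdot> \<s> a (b \<otimes> c) \<cdot> \<alpha> a b c
        = (\<one> b \<odot> \<s> a c) \<cdot> \<alpha> b a c \<cdot> (\<s> a b \<odot> \<one> c)"

fun tensor_list :: "('o, 'm, 'z) smc_scheme \<Rightarrow> 'o list \<Rightarrow> 'o" where
  "tensor_list C [] = unit_obj C"
| "tensor_list C [a] = a"
| "tensor_list C (a # b # as) = tensor_obj C a (tensor_list C (b # as))"


section \<open>The monoidal category of symmetric monoidal endofunctors\<close>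

record ('o, 'm) endofunctor =
  fobj :: "'o \<Rightarrow> 'o"
  farr :: "'m \<Rightarrow> 'm"
  funit :: "'m"
  fmult :: "'o \<Rightarrow> 'o \<Rightarrow> 'm"

text \<open>Symmetric monoidal functors are strong: \<open>funit\<close> and \<open>fmult\<close> consist of isomorphisms.\<close>

locale symmetric_monoidal_endofunctor = symmetric_monoidal_category C
  for C :: "('o, 'm, 'z) smc_scheme" (structure) and F :: "('o, 'm) endofunctor" +
  assumes fobj_in_Obj: "a \<in> Obj C \<Longrightarrow> fobj F a \<in> Obj C"
    and farr_in_hom: "f \<in> hom C a b \<Longrightarrow> farr F f \<in> hom C (fobj F a) (fobj F b)"
    and farr_ident: "a \<in> Obj C \<Longrightarrow> farr F (\<one> a) = \<one> (fobj F a)"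
    and farr_comp: "f \<in> hom C a b \<Longrightarrow> g \<in> hom C b c \<Longrightarrow> farr F (g \<cdot> f) = farr F g \<cdot> farr F f"
    and funit_iso: "funit F \<in> iso C \<I> (fobj F \<I>)"
    and fmult_iso: "a \<in> Obj C \<Longrightarrow> b \<in> Obj C
      \<Longrightarrow> fmult F a b \<in> iso C (fobj F a \<otimes> fobj F b) (fobj F (a \<otimes> b))"
    and fmult_natural: "f \<in> hom C a a' \<Longrightarrow> g \<in> hom C b b'
      \<Longrightarrow> fmult F a' b' \<cdot> (farr F f \<odot> farr F g) = farr F (f \<odot> g) \<cdot> fmult F a b"
    and fmult_assoc: "a \<in> Obj C \<Longrightarrow> b \<in> Obj C \<Longrightarrow> c \<in> Obj C
      \<Longrightarrow> farr F (\<alpha> a b c) \<cdot> fmult F (a \<otimes> b) c \<cdot> (fmult F a b \<odot> \<one> (fobj F c))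
        = fmult F a (b \<otimes> c) \<cdot> (\<one> (fobj F a) \<odot> fmult F b c) \<cdot> \<alpha> (fobj F a) (fobj F b) (fobj F c)"
    and fmult_left_unit: "a \<in> Obj C
      \<Longrightarrow> farr F (\<l> a) \<cdot> fmult F \<I> a \<cdot> (funit F \<odot> \<one> (fobj F a)) = \<l> (fobj F a)"
    and fmult_right_unit: "a \<in> Obj C
      \<Longrightarrow> farr F (\<r> a) \<cdot> fmult F a \<I> \<cdot> (\<one> (fobj F a) \<odot> funit F) = \<r> (fobj F a)"
    and fmult_symmetry: "a \<in> Obj C \<Longrightarrow> b \<in> Obj C
      \<Longrightarrow> farr F (\<s> a b) \<cdot> fmult F a b = fmult F b a \<cdot> \<s> (fobj F a) (fobj F b)"

definition id_endofunctor :: "('o, 'm, 'z) smc_scheme \<Rightarrow> ('o, 'm) endofunctor" where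
  "id_endofunctor C =
     \<lparr>fobj = (\<lambda>a. a), farr = (\<lambda>f. f),
      funit = ident C (unit_obj C),
      fmult = (\<lambda>a b. ident C (tensor_obj C a b))\<rparr>"

definition comp_endofunctor ::
  "('o, 'm, 'z) smc_scheme \<Rightarrow> ('o, 'm) endofunctor \<Rightarrow> ('o, 'm) endofunctor \<Rightarrow> ('o, 'm) endofunctor"
where
  "comp_endofunctor C F G =
     \<lparr>fobj = fobj F \<circ> fobj G, farr = farr F \<circ> farr G,
      funit = compose C (farr F (funit G)) (funit F),
      fmult = (\<lambda>a b. compose C (farr F (fmult G a b)) (fmult F (fobj G a) (fobj G b)))\<rparr>"

definition monoidal_natural_iso ::
  "('o, 'm, 'z) smc_scheme \<Rightarrow> ('o, 'm) endofunctor \<Rightarrow> ('o, 'm) endofunctor \<Rightarrow> ('o \<Rightarrow> 'm) \<Rightarrow> bool"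
where
  "monoidal_natural_iso C F G \<tau> \<longleftrightarrow>
     (\<forall>a \<in> Obj C. \<tau> a \<in> iso C (fobj F a) (fobj G a)) \<and>
     (\<forall>a b. \<forall>f \<in> hom C a b. compose C (\<tau> b) (farr F f) = compose C (farr G f) (\<tau> a)) \<and>
     compose C (\<tau> (unit_obj C)) (funit F) = funit G \<and>
     (\<forall>a \<in> Obj C. \<forall>b \<in> Obj C.
        compose C (\<tau> (tensor_obj C a b)) (fmult F a b)
        = compose C (fmult G a b) (tensor_arr C (\<tau> a) (\<tau> b)))"

text \<open>
  A (strong) monoidal functor \<open>x \<mapsto> Sh x\<close> from the discrete category of real numbers, monoidal
  under addition, to the category of symmetric monoidal endofunctors and monoidal natural
  transformations, monoidal under composition; \<open>\<epsilon>\<close> and \<open>\<mu>\<close> are its structure isomorphisms.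
  As the source is discrete, functoriality and naturality in the real arguments are vacuous.
\<close>

locale real_shift_action = symmetric_monoidal_category C
  for C :: "('o, 'm, 'z) smc_scheme" (structure)
    and Sh :: "real \<Rightarrow> ('o, 'm) endofunctor"
    and \<epsilon> :: "'o \<Rightarrow> 'm"
    and \<mu> :: "real \<Rightarrow> real \<Rightarrow> 'o \<Rightarrow> 'm" +
  assumes shift_functor: "symmetric_monoidal_endofunctor C (Sh x)"
    and shift_zero: "monoidal_natural_iso C (id_endofunctor C) (Sh 0) \<epsilon>"
    and shift_add: "monoidal_natural_iso C (comp_endofunctor C (Sh x) (Sh y)) (Sh (x + y)) (\<mu> x y)"
    and shift_assoc: "a \<in> Obj C
      \<Longrightarrow> \<mu> (x + y) z a \<cdot> \<mu> x y (fobj (Sh z) a) = \<mu> x (y + z) a \<cdot> farr (Sh x) (\<mu> y z a)"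
    and shift_left_unit: "a \<in> Obj C \<Longrightarrow> \<mu> 0 x a \<cdot> \<epsilon> (fobj (Sh x) a) = \<one> (fobj (Sh x) a)"
    and shift_right_unit: "a \<in> Obj C \<Longrightarrow> \<mu> x 0 a \<cdot> farr (Sh x) (\<epsilon> a) = \<one> (fobj (Sh x) a)"


section \<open>Categorical models of the annotated language\<close>

text \<open>
  A gate \<open>g \<in> G\<close> has duration \<open>dur g\<close> and acts on the tuple \<open>qubits g\<close>. The set \<open>D\<close> collects the
  real numbers \<open>x\<close> for which a delay morphism is required. It is a parameter because the signal
  category admits delays only for \<open>D \<subseteq> {0..}\<close> (see \<open>no_negative_delay\<close> below), whereas the shift
  functors exist for all real numbers.
\<close>

locale categorical_model = real_shift_action C Sh \<epsilon> \<mu>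
  for C :: "('o, 'm, 'z) smc_scheme" (structure)
    and Q :: "'q set"
    and G :: "'g set"
    and dur :: "'g \<Rightarrow> real"
    and qubits :: "'g \<Rightarrow> 'q list"
    and D :: "real set"
    and X :: "'q \<Rightarrow> 'o"
    and f :: "'g \<Rightarrow> 'm"
    and Sh :: "real \<Rightarrow> ('o, 'm) endofunctor"
    and \<epsilon> :: "'o \<Rightarrow> 'm"
    and \<mu> :: "real \<Rightarrow> real \<Rightarrow> 'o \<Rightarrow> 'm"
    and delay :: "real \<Rightarrow> 'q \<Rightarrow> 'm" +
  assumes qubit_in_Obj: "q \<in> Q \<Longrightarrow> X q \<in> Obj C"
    and gate_in_hom: "g \<in> G \<Longrightarrow> f g \<in>
      hom C (fobj (Sh (- dur g)) (tensor_list C (map X (qubits g))))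
            (tensor_list C (map X (qubits g)))"
    and delay_in_hom: "x \<in> D \<Longrightarrow> q \<in> Q \<Longrightarrow> delay x q \<in> hom C (fobj (Sh (- x)) (X q)) (X q)"


section \<open>The category of signals\<close>

type_synonym 'c sobj = "(real \<times> 'c) list"

text \<open>
  Morphisms are tagged with their source and target. Positions are counted from 0, so that a
  permutation in \<open>S\<^sub>n\<close> is a function that permutes \<open>{..<n}\<close> (and is the identity elsewhere).
  Pulses on \<open>[s, t)\<close> are extensional functions, i.e. \<open>undefined\<close> outside \<open>{s..<t}\<close>; the empty
  function is \<open>\<lambda>_. undefined\<close>.
\<close>

record 'c signal =
  src :: "'c sobj"
  tgt :: "'c sobj"
  perm :: "nat \<Rightarrow> nat"
  pulses :: "(real \<Rightarrow> real) list"

definition is_signal :: "'c set \<Rightarrow> 'c signal \<Rightarrow> bool" where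
  "is_signal C f \<longleftrightarrow>
     src f \<in> lists (UNIV \<times> C) \<and> tgt f \<in> lists (UNIV \<times> C) \<and>
     length (src f) = length (tgt f) \<and>
     perm f permutes {..<length (src f)} \<and>
     length (pulses f) = length (src f) \<and>
     (\<forall>k < length (src f).
        snd (src f ! k) = snd (tgt f ! perm f k) \<and>
        fst (src f ! k) \<le> fst (tgt f ! perm f k) \<and>
        pulses f ! k \<in> {fst (src f ! k)..<fst (tgt f ! perm f k)} \<rightarrow>\<^sub>E UNIV)"

definition empty_pulses :: "nat \<Rightarrow> (real \<Rightarrow> real) list" where
  "empty_pulses n = replicate n (\<lambda>_. undefined)"

definition signal_id :: "'c sobj \<Rightarrow> 'c signal" where
  "signal_id X = \<lparr>src = X, tgt = X, perm = id, pulses = empty_pulses (length X)\<rparr>"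

definition signal_comp :: "'c signal \<Rightarrow> 'c signal \<Rightarrow> 'c signal" where
  "signal_comp g f =
     \<lparr>src = src f, tgt = tgt g, perm = perm g \<circ> perm f,
      pulses = map
        (\<lambda>k. \<lambda>u \<in> {fst (src f ! k)..<fst (tgt g ! (perm g \<circ> perm f) k)}.
           if u < fst (tgt f ! perm f k) then (pulses f ! k) u else (pulses g ! perm f k) u)
        [0..<length (src f)]\<rparr>"

definition block_sum :: "nat \<Rightarrow> (nat \<Rightarrow> nat) \<Rightarrow> (nat \<Rightarrow> nat) \<Rightarrow> nat \<Rightarrow> nat" where
  "block_sum m \<sigma> \<tau> k = (if k < m then \<sigma> k else m + \<tau> (k - m))"

definition signal_tensor :: "'c signal \<Rightarrow> 'c signal \<Rightarrow> 'c signal" where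
  "signal_tensor f g =
     \<lparr>src = src f @ src g, tgt = tgt f @ tgt g,
      perm = block_sum (length (src f)) (perm f) (perm g),
      pulses = pulses f @ pulses g\<rparr>"

definition block_swap :: "nat \<Rightarrow> nat \<Rightarrow> nat \<Rightarrow> nat" where
  "block_swap m n k = (if k < m then k + n else if k < m + n then k - m else k)"

definition signal_symmetry :: "'c sobj \<Rightarrow> 'c sobj \<Rightarrow> 'c signal" where
  "signal_symmetry X Y =
     \<lparr>src = X @ Y, tgt = Y @ X, perm = block_swap (length X) (length Y),
      pulses = empty_pulses (length X + length Y)\<rparr>"

definition signals :: "'c set \<Rightarrow> ('c sobj, 'c signal) smc" where
  "signals C =
     \<lparr>Obj = lists (UNIV \<times> C), Arr = {f. is_signal C f}, Dom = src, Cod = tgt,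
      ident = signal_id, compose = signal_comp,
      tensor_obj = (@), tensor_arr = signal_tensor, unit_obj = [],
      associator = (\<lambda>X Y Z. signal_id (X @ Y @ Z)),
      left_unitor = signal_id, right_unitor = signal_id,
      symmetry = signal_symmetry\<rparr>"

definition shift_obj :: "real \<Rightarrow> 'c sobj \<Rightarrow> 'c sobj" where
  "shift_obj x X = map (\<lambda>(t, c). (t + x, c)) X"

definition shift_arr :: "real \<Rightarrow> 'c signal \<Rightarrow> 'c signal" where
  "shift_arr x f =
     \<lparr>src = shift_obj x (src f), tgt = shift_obj x (tgt f), perm = perm f,
      pulses = map (\<lambda>\<phi> u. \<phi> (u - x)) (pulses f)\<rparr>"

text \<open>
  The delay morphism on an arbitrary object \<open>X\<close>; on a one-element object it consists of the
  identity of \<open>S\<^sub>1\<close> and a single zero pulse.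
\<close>

definition signal_delay :: "real \<Rightarrow> 'c sobj \<Rightarrow> 'c signal" where
  "signal_delay x X =
     \<lparr>src = shift_obj (- x) X, tgt = X, perm = id,
      pulses = map (\<lambda>(t, c). \<lambda>u \<in> {t - x..<t}. 0) X\<rparr>"

lemma signal_delay_singleton:
  "signal_delay x [(t, c)] =
     \<lparr>src = [(t - x, c)], tgt = [(t, c)], perm = id, pulses = [\<lambda>u \<in> {t - x..<t}. 0]\<rparr>"
  by (simp add: signal_delay_def shift_obj_def)

lemma no_negative_delay:
  assumes "x < 0" and "X \<noteq> []"
  shows "hom (signals C) (shift_obj (- x) X) X = {}"
proof (rule ccontr)
  let ?n = "length X"
  assume "\<not> ?thesis"
  then obtain f where f: "is_signal C f" "src f = shift_obj (- x) X" "tgt f = X"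
    by (auto simp: hom_def signals_def)
  have len: "length (shift_obj (- x) X) = ?n"
    by (simp add: shift_obj_def)
  have p: "perm f permutes {..<?n}"
    using f by (simp add: is_signal_def len)
  have le: "fst (X ! k) - x \<le> fst (X ! perm f k)" if "k < ?n" for k
    using f that by (auto simp: is_signal_def len shift_obj_def case_prod_beta)
  have "(\<Sum>k<?n. fst (X ! k)) < (\<Sum>k<?n. fst (X ! k) - x)"
    using assms by (intro sum_strict_mono) auto
  also have "\<dots> \<le> (\<Sum>k<?n. fst (X ! perm f k))"
    using le by (intro sum_mono) auto
  also have "\<dots> = (\<Sum>k<?n. fst (X ! k))"
    using sum.permute[OF p, of "\<lambda>k. fst (X ! k)"] by (simp add: o_def)
  finally show False by simp
qed

end

theory Submission
  imports Defs
begin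

text \<open>
  Two signals with the same source and target agree as soon as their permutations agree on the
  positions and their pulses agree on the intervals \<open>[s, t)\<close>. For the structural morphisms these
  intervals are empty, so every coherence law is an identity between permutations, trivial for
  the laws that do not involve the symmetry. The shift functors are strict as well:
  \<open>Shift x\<close> commutes with concatenation and \<open>Shift x \<circ> Shift y = Shift (x + y)\<close> on the nose, so that
  identities serve as the structure isomorphisms.
\<close>

section \<open>Projections of the constructions, and extensionality of signals\<close>

lemma signals_simps [simp]:
  "Obj (signals C) = lists (UNIV \<times> C)" "Arr (signals C) = {f. is_signal C f}"
  "Dom (signals C) = src" "Cod (signals C) = tgt"
  "ident (signals C) = signal_id" "compose (signals C) = signal_comp"
  "tensor_obj (signals C) = (@)" "tensor_arr (signals C) = signal_tensor"
  "unit_obj (signals C) = []"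
  "associator (signals C) = (\<lambda>X Y Z. signal_id (X @ Y @ Z))"
  "left_unitor (signals C) = signal_id" "right_unitor (signals C) = signal_id"
  "symmetry (signals C) = signal_symmetry"
  by (simp_all add: signals_def)

lemma in_hom_signals [simp]:
  "f \<in> hom (signals C) a b \<longleftrightarrow> is_signal C f \<and> src f = a \<and> tgt f = b"
  by (auto simp: hom_def)

lemma signal_sel [simp]:
  "src (signal_id X) = X" "tgt (signal_id X) = X" "perm (signal_id X) = id"
  "src (signal_comp g f) = src f" "tgt (signal_comp g f) = tgt g"
  "perm (signal_comp g f) = perm g \<circ> perm f"
  "src (signal_tensor f g) = src f @ src g" "tgt (signal_tensor f g) = tgt f @ tgt g"
  "perm (signal_tensor f g) = block_sum (length (src f)) (perm f) (perm g)"
  "pulses (signal_tensor f g) = pulses f @ pulses g"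
  "src (signal_symmetry X Y) = X @ Y" "tgt (signal_symmetry X Y) = Y @ X"
  "perm (signal_symmetry X Y) = block_swap (length X) (length Y)"
  "src (shift_arr x f) = shift_obj x (src f)" "tgt (shift_arr x f) = shift_obj x (tgt f)"
  "perm (shift_arr x f) = perm f"
  by (simp_all add: signal_id_def signal_comp_def signal_tensor_def signal_symmetry_def
      shift_arr_def)

lemma pulses_id_nth [simp]: "k < length X \<Longrightarrow> pulses (signal_id X) ! k = (\<lambda>_. undefined)"
  by (simp add: signal_id_def empty_pulses_def)

lemma pulses_symmetry_nth [simp]:
  "k < length X + length Y \<Longrightarrow> pulses (signal_symmetry X Y) ! k = (\<lambda>_. undefined)"
  by (simp add: signal_symmetry_def empty_pulses_def)

lemma pulses_comp_nth [simp]: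
  "k < length (src f) \<Longrightarrow> pulses (signal_comp g f) ! k =
     (\<lambda>u \<in> {fst (src f ! k)..<fst (tgt g ! perm g (perm f k))}.
        if u < fst (tgt f ! perm f k) then (pulses f ! k) u else (pulses g ! perm f k) u)"
  by (simp add: signal_comp_def cong: if_cong)

lemma length_pulses [simp]:
  "length (pulses (signal_id X)) = length X"
  "length (pulses (signal_comp g f)) = length (src f)"
  "length (pulses (signal_symmetry X Y)) = length X + length Y"
  "length (pulses (shift_arr x f)) = length (pulses f)"
  by (simp_all add: signal_id_def signal_comp_def signal_symmetry_def shift_arr_def
      empty_pulses_def)

text \<open>Membership in \<open>lists (UNIV \<times> C)\<close> stays opaque, so that it matches
  the premises of rules such as \<open>is_signal_id\<close> instead of dissolving into statements
  about entries.\<close>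

declare in_lists_conv_set [simp del] in_listsD [rule del] in_listsI [rule del]

text \<open>Extensionality of the pulses becomes a pointwise fact about the value
  \<open>undefined\<close>, which linear arithmetic on the endpoints can trigger. The bound on
  \<open>perm f k\<close> comes from a permutation preserving its carrier.\<close>

lemma is_signalD:
  assumes "is_signal C f"
  shows "src f \<in> lists (UNIV \<times> C)" "tgt f \<in> lists (UNIV \<times> C)"
    and "length (tgt f) = length (src f)" "length (pulses f) = length (src f)"
    and "perm f permutes {..<length (src f)}"
    and "k < length (src f) \<Longrightarrow> perm f k < length (src f)"
    and "k < length (src f) \<Longrightarrow> snd (tgt f ! perm f k) = snd (src f ! k)"
    and "k < length (src f) \<Longrightarrow> fst (src f ! k) \<le> fst (tgt f ! perm f k)"
    and "k < length (src f) \<Longrightarrow>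
      \<not> (fst (src f ! k) \<le> u \<and> u < fst (tgt f ! perm f k)) \<Longrightarrow> (pulses f ! k) u = undefined"
proof -
  show p: "perm f permutes {..<length (src f)}"
    using assms unfolding is_signal_def by blast
  show "perm f k < length (src f)" if "k < length (src f)"
    using permutes_in_image[OF p, of k] that by simp
  show "(pulses f ! k) u = undefined" if "k < length (src f)"
    "\<not> (fst (src f ! k) \<le> u \<and> u < fst (tgt f ! perm f k))"
  proof -
    have "pulses f ! k \<in> {fst (src f ! k)..<fst (tgt f ! perm f k)} \<rightarrow>\<^sub>E UNIV"
      using assms that(1) unfolding is_signal_def by blast
    from PiE_arb[OF this] that(2) show ?thesis
      by simp
  qed
qed (use assms in \<open>auto simp: is_signal_def\<close>)

text \<open>Beyond the positions both permutations are the identity, and outside the intervals both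
  pulses are \<open>undefined\<close>; hence only the stated ranges have to be compared.\<close>

lemma signal_eqI:
  assumes f: "is_signal C f" and g: "is_signal C g"
    and st: "src f = src g" "tgt f = tgt g"
    and pm: "\<And>k. k < length (src g) \<Longrightarrow> perm f k = perm g k"
    and pl: "\<And>k u. k < length (src g) \<Longrightarrow> fst (src g ! k) \<le> u \<Longrightarrow> u < fst (tgt g ! perm g k)
      \<Longrightarrow> (pulses f ! k) u = (pulses g ! k) u"
  shows "f = g"
proof (rule signal.equality)
  show perm: "perm f = perm g"
  proof
    fix k
    show "perm f k = perm g k"
      using pm[of k] permutes_not_in[OF is_signalD(5)[OF f], of k]
        permutes_not_in[OF is_signalD(5)[OF g], of k] st by (cases "k < length (src g)") auto
  qed
  show "pulses f = pulses g"
  proof (intro nth_equalityI ext)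
    fix k u assume "k < length (pulses f)"
    then have k: "k < length (src g)"
      using is_signalD(4)[OF f] st by simp
    show "(pulses f ! k) u = (pulses g ! k) u"
      using pl[OF k, of u] is_signalD(9)[OF f, of k u] is_signalD(9)[OF g, of k u] k st perm
      by fastforce
  qed (simp add: is_signalD(4)[OF f] is_signalD(4)[OF g] st)
qed (simp_all add: st)

lemma is_signalI:
  assumes "src f \<in> lists (UNIV \<times> C)" "tgt f \<in> lists (UNIV \<times> C)"
    and "length (tgt f) = length (src f)" "length (pulses f) = length (src f)"
    and "perm f permutes {..<length (src f)}"
    and "\<And>k. k < length (src f) \<Longrightarrow> snd (tgt f ! perm f k) = snd (src f ! k)"
    and "\<And>k. k < length (src f) \<Longrightarrow> fst (src f ! k) \<le> fst (tgt f ! perm f k)"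
    and "\<And>k u. k < length (src f) \<Longrightarrow>
      \<not> (fst (src f ! k) \<le> u \<and> u < fst (tgt f ! perm f k)) \<Longrightarrow> (pulses f ! k) u = undefined"
  shows "is_signal C f"
  using assms by (auto simp: is_signal_def PiE_def extensional_def)

subsection \<open>The category of signals\<close>

lemma is_signal_id [simp]: "X \<in> lists (UNIV \<times> C) \<Longrightarrow> is_signal C (signal_id X)"
  by (rule is_signalI) (auto simp: permutes_id)

lemma is_signal_comp [simp]:
  assumes "is_signal C f" "is_signal C g" "tgt f = src g"
  shows "is_signal C (signal_comp g f)"
proof (rule is_signalI)
  note F = is_signalD[OF assms(1)] and G = is_signalD[OF assms(2)]
  have len: "length (src g) = length (src f)"
    using F(3) assms(3) by simp
  show "perm (signal_comp g f) permutes {..<length (src (signal_comp g f))}"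
    using permutes_compose[OF F(5)] G(5) len by simp
  \<comment> \<open>The two inequalities are chained through the intermediate time, the second one
    taken at position \<open>perm f k\<close> of \<open>g\<close>.\<close>
  show "fst (src (signal_comp g f) ! k)
      \<le> fst (tgt (signal_comp g f) ! perm (signal_comp g f) k)"
    if "k < length (src (signal_comp g f))" for k
    using F(6,8)[of k] G(8)[of "perm f k"] that len assms(3) by simp
qed (use is_signalD[OF assms(1)] is_signalD[OF assms(2)] assms(3) in auto)

text \<open>The value of \<open>block_sum\<close> reveals the block of its argument, because
  \<open>\<sigma>\<close> maps below \<open>m\<close> exactly the numbers below \<open>m\<close>.
  This gives injectivity, and an injective self-map of a finite set is bijective.\<close>

lemma block_sum_permutes:
  assumes "\<sigma> permutes {..<m}" "\<tau> permutes {..<n}"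
  shows "block_sum m \<sigma> \<tau> permutes {..<m + n}"
proof (rule bij_imp_permutes)
  have s: "\<sigma> k < m \<longleftrightarrow> k < m" and t: "\<tau> k < n \<longleftrightarrow> k < n" for k
    using permutes_in_image[OF assms(1), of k] permutes_in_image[OF assms(2), of k] by auto
  have "inj_on (block_sum m \<sigma> \<tau>) {..<m + n}"
  proof (rule inj_onI)
    fix i j assume "block_sum m \<sigma> \<tau> i = block_sum m \<sigma> \<tau> j"
    then show "i = j"
      using s[of i] s[of j] injD[OF permutes_inj[OF assms(1)], of i j]
        injD[OF permutes_inj[OF assms(2)], of "i - m" "j - m"]
      by (auto simp: block_sum_def split: if_splits)
  qed
  moreover have "block_sum m \<sigma> \<tau> ` {..<m + n} \<subseteq> {..<m + n}"
  proof clarsimp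
    fix k assume "k < m + n"
    then show "block_sum m \<sigma> \<tau> k < m + n"
      using s[of k] t[of "k - m"] by (cases "k < m") (simp_all add: block_sum_def)
  qed
  ultimately show "bij_betw (block_sum m \<sigma> \<tau>) {..<m + n} {..<m + n}"
    by (simp add: bij_betw_def endo_inj_surj)
  \<comment> \<open>Here \<open>k - m\<close> lies outside \<open>{..<n}\<close>, so
    \<open>\<tau>\<close> fixes it, and \<open>m + (k - m) = k\<close> since
    \<open>k \<ge> m\<close>.\<close>
  show "block_sum m \<sigma> \<tau> k = k" if "k \<notin> {..<m + n}" for k
    using that permutes_not_in[OF assms(2), of "k - m"] by (auto simp: block_sum_def)
qed

lemma block_swap_permutes: "block_swap m n permutes {..<m + n}"
  by (rule bij_imp_permutes)
    \<comment> \<open>The inverse exchanges the blocks back, hence the swapped arguments.\<close>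
    (auto intro!: bij_betw_byWitness[where f' = "block_swap n m"] simp: block_swap_def)

lemma is_signal_tensor [simp]:
  assumes "is_signal C f" "is_signal C g"
  shows "is_signal C (signal_tensor f g)"
proof -
  note F = is_signalD[OF assms(1)] and G = is_signalD[OF assms(2)]
  show ?thesis
    by (rule is_signalI)
      (use F G block_sum_permutes[OF F(5) G(5)] in \<open>auto simp: block_sum_def nth_append\<close>)
qed

lemma is_signal_symmetry [simp]:
  assumes "X \<in> lists (UNIV \<times> C)" "Y \<in> lists (UNIV \<times> C)"
  shows "is_signal C (signal_symmetry X Y)"
  by (rule is_signalI)
    (use assms block_swap_permutes[of "length X" "length Y"] in
      \<open>auto simp: block_swap_def nth_append\<close>)

section \<open>Category laws, interchange, strictness and symmetry\<close>

lemma comp_id_left: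
  assumes "is_signal C f" "tgt f = X"
  shows "signal_comp (signal_id X) f = f"
  by (rule signal_eqI[of C])
    (use assms is_signalD[OF assms(1)] in auto)

text \<open>The time at which a composite switches pulses is the left end of the interval here and
  the right end in \<open>comp_id_left\<close>; either way only the pulse of \<open>f\<close> is
  read.\<close>

lemma comp_id_right:
  assumes "is_signal C f" "src f = X"
  shows "signal_comp f (signal_id X) = f"
  by (rule signal_eqI[of C])
    (use assms is_signalD[OF assms(1)] in auto)

lemma comp_id_id [simp]: "signal_comp (signal_id X) (signal_id X) = signal_id X"
  by (rule signal.equality) (auto simp: list_eq_iff_nth_eq restrict_def)

lemma tensor_id_id [simp]: "signal_tensor (signal_id X) (signal_id Y) = signal_id (X @ Y)"
  by (rule signal.equality)
    (auto simp: signal_id_def empty_pulses_def replicate_add block_sum_def fun_eq_iff)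

text \<open>Both sides switch pulses at the same two times. The time inequality for \<open>g\<close>
  orders these, so the two nestings of the case distinction agree.\<close>

lemma comp_assoc_signal:
  assumes "is_signal C f" "is_signal C g" "is_signal C h" "tgt f = src g" "tgt g = src h"
  shows "signal_comp (signal_comp h g) f = signal_comp h (signal_comp g f)"
proof -
  note F = is_signalD[OF assms(1)] and G = is_signalD[OF assms(2)] and H = is_signalD[OF assms(3)]
  have len: "length (src g) = length (src f)"
    using F(3) assms(4) by simp
  show ?thesis
  proof (rule signal_eqI[of C])
    fix k u
    assume "k < length (src (signal_comp h (signal_comp g f)))"
    then have k: "k < length (src f)" "perm f k < length (src f)"
      using F(6)[of k] by simp_all
    show "(pulses (signal_comp (signal_comp h g) f) ! k) u
        = (pulses (signal_comp h (signal_comp g f)) ! k) u"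
      using k len F(8)[of k] G(8)[of "perm f k"] assms(4,5) by (auto simp: restrict_def)
  qed (use assms in auto)
qed

lemma interchange_signal:
  assumes "is_signal C f" "is_signal C g" "tgt f = src g"
    "is_signal C f'" "is_signal C g'" "tgt f' = src g'"
  shows "signal_tensor (signal_comp g f) (signal_comp g' f')
    = signal_comp (signal_tensor g g') (signal_tensor f f')"
proof -
  note F = is_signalD[OF assms(1)] and G = is_signalD[OF assms(2)]
  note F' = is_signalD[OF assms(4)] and G' = is_signalD[OF assms(5)]
  have len: "length (src g) = length (src f)" "length (src g') = length (src f')"
    using F(3) F'(3) assms(3,6) by simp_all
  show ?thesis
    by (rule signal_eqI[of C])
      (use assms len F(3,4,6) G(3,4,6) F'(3,4,6) G'(3,4,6) in
        \<open>auto simp: block_sum_def nth_append restrict_def\<close>)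
qed

text \<open>Block offsets add up and lists concatenate associatively, so this is an equality of raw
  records.\<close>

lemma tensor_assoc_signal:
  "signal_tensor (signal_tensor f g) h = signal_tensor f (signal_tensor g h)"
  by (rule signal.equality) (auto simp: block_sum_def fun_eq_iff)

lemma tensor_unit_left [simp]: "signal_tensor (signal_id []) f = f"
  by (rule signal.equality) (auto simp: block_sum_def fun_eq_iff signal_id_def empty_pulses_def)

text \<open>In contrast to \<open>tensor_unit_left\<close>, the block sum overwrites
  \<open>perm f\<close> beyond its positions by the identity; well-formedness of \<open>f\<close>
  says that it was the identity there already.\<close>

lemma tensor_unit_right:
  assumes "is_signal C f"
  shows "signal_tensor f (signal_id []) = f"
  by (rule signal_eqI[of C])
    (use assms is_signalD[OF assms] in \<open>auto simp: block_sum_def nth_append\<close>)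

text \<open>This is why a symmetry has only empty intervals: start and end time agree at every
  position.\<close>

lemma nth_block_swap [simp]:
  "k < length X + length Y \<Longrightarrow> (Y @ X) ! block_swap (length X) (length Y) k = (X @ Y) ! k"
  by (auto simp: block_swap_def nth_append)

lemma symmetry_natural_signal:
  assumes "is_signal C f" "is_signal C g"
  shows "signal_comp (signal_symmetry (tgt f) (tgt g)) (signal_tensor f g)
    = signal_comp (signal_tensor g f) (signal_symmetry (src f) (src g))" (is "?l = ?r")
proof (rule signal_eqI[of C])
  note F = is_signalD[OF assms(1)] and G = is_signalD[OF assms(2)]
  show "is_signal C ?l" "is_signal C ?r"
    using assms F(1,2) G(1,2) by simp_all
  show "perm ?l k = perm ?r k" if "k < length (src ?r)" for k
    using that F(3,6) G(3) G(6)[of "k - length (src f)"]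
    by (cases "k < length (src f)") (auto simp: block_sum_def block_swap_def)
  show "(pulses ?l ! k) u = (pulses ?r ! k) u"
    if "k < length (src ?r)" "fst (src ?r ! k) \<le> u" "u < fst (tgt ?r ! perm ?r k)" for k u
  \<comment> \<open>By \<open>nth_block_swap\<close>, \<open>?l\<close> switches pulses at the right
    end of the interval and \<open>?r\<close> at the left end. Both reduce to the pulse of the
    factor containing position \<open>k\<close>.\<close>
  proof (cases "k < length (src f)")
    case True
    then show ?thesis
      using that F(3,4,6) G(3,4) by (simp add: block_sum_def block_swap_def nth_append)
  next
    case False
    then have "k - length (src f) < length (src g)"
      using that by simp
    then show ?thesis
      using False that F(3,4) G(3,4,6) by (simp add: block_sum_def block_swap_def nth_append)
  qed
qed simp_all

lemma symmetry_involutive_signal: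
  assumes "X \<in> lists (UNIV \<times> C)" "Y \<in> lists (UNIV \<times> C)"
  shows "signal_comp (signal_symmetry Y X) (signal_symmetry X Y) = signal_id (X @ Y)"
  by (rule signal_eqI[of C]) (use assms in \<open>auto simp: block_swap_def\<close>)

text \<open>This is what remains of the hexagon axiom after the identity associators are
  absorbed.\<close>

lemma hexagon_signal:
  assumes "X \<in> lists (UNIV \<times> C)" "Y \<in> lists (UNIV \<times> C)" "Z \<in> lists (UNIV \<times> C)"
  shows "signal_comp (signal_tensor (signal_id Y) (signal_symmetry X Z))
      (signal_tensor (signal_symmetry X Y) (signal_id Z)) = signal_symmetry X (Y @ Z)"
proof (rule signal_eqI[of C])
  fix k u
  assume "k < length (src (signal_symmetry X (Y @ Z)))"
    "fst (src (signal_symmetry X (Y @ Z)) ! k) \<le> u"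
    "u < fst (tgt (signal_symmetry X (Y @ Z)) ! perm (signal_symmetry X (Y @ Z)) k)"
  \<comment> \<open>The interval of a symmetry is empty, so there is no \<open>u\<close> at which
    pulses have to be compared.\<close>
  then have False
    using nth_block_swap[of k X "Y @ Z"] by simp
  then show "(pulses (signal_comp (signal_tensor (signal_id Y) (signal_symmetry X Z))
      (signal_tensor (signal_symmetry X Y) (signal_id Z))) ! k) u
      = (pulses (signal_symmetry X (Y @ Z)) ! k) u" ..
qed (use assms in \<open>auto simp: block_swap_def block_sum_def\<close>)

text \<open>All isomorphism conditions, on associators and unitors as well as on the structure of
  the shifts, reduce to this, since their sources and targets are equal lists.\<close>

lemma id_in_iso [simp]: "X \<in> lists (UNIV \<times> C) \<Longrightarrow> signal_id X \<in> iso (signals C) X X"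
  by (auto simp: iso_def intro!: bexI[of _ "signal_id X"])

theorem symmetric_monoidal_category_signals: "symmetric_monoidal_category (signals C)"
  by unfold_locales
    (auto simp: is_signalD(1,2) comp_id_left[of C] comp_id_right[of C] comp_assoc_signal[of C]
      interchange_signal[of C] tensor_assoc_signal tensor_unit_right[of C]
      symmetry_natural_signal[of C] symmetry_involutive_signal[of _ C] hexagon_signal[of _ C])

subsection \<open>The shift functors\<close>

lemma shift_obj_in_lists [simp]:
  "X \<in> lists (UNIV \<times> C) \<Longrightarrow> shift_obj x X \<in> lists (UNIV \<times> C)"
  by (auto simp: shift_obj_def in_lists_conv_set)

lemma shift_obj_simps [simp]:
  "shift_obj x [] = []"
  "shift_obj x (X @ Y) = shift_obj x X @ shift_obj x Y"
  "length (shift_obj x X) = length X"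
  "shift_obj 0 X = X"
  "shift_obj x (shift_obj y X) = shift_obj (x + y) X"
  "k < length X \<Longrightarrow> fst (shift_obj x X ! k) = fst (X ! k) + x"
  "k < length X \<Longrightarrow> snd (shift_obj x X ! k) = snd (X ! k)"
  by (auto simp: shift_obj_def case_prod_beta)

lemma pulses_shift_nth [simp]:
  "k < length (pulses f) \<Longrightarrow> pulses (shift_arr x f) ! k = (\<lambda>u. (pulses f ! k) (u - x))"
  by (simp add: shift_arr_def)

text \<open>Translating the argument moves the interval and the region of value
  \<open>undefined\<close> alike, so pulses stay extensional.\<close>

lemma is_signal_shift [simp]:
  assumes "is_signal C f"
  shows "is_signal C (shift_arr x f)"
  by (rule is_signalI) (use is_signalD[OF assms] in auto)

lemma shift_id [simp]: "shift_arr x (signal_id X) = signal_id (shift_obj x X)"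
  by (rule signal.equality) (auto simp: list_eq_iff_nth_eq)

text \<open>The switching time moves along with the interval: \<open>u - x < s\<close> iff
  \<open>u < s + x\<close>.\<close>

lemma shift_comp:
  assumes "is_signal C f" "is_signal C g" "tgt f = src g"
  shows "shift_arr x (signal_comp g f) = signal_comp (shift_arr x g) (shift_arr x f)"
proof (rule signal_eqI[of C])
  note F = is_signalD[OF assms(1)] and G = is_signalD[OF assms(2)]
  have len: "length (src g) = length (src f)"
    using F(3) assms(3) by simp
  show "(pulses (shift_arr x (signal_comp g f)) ! k) u
      = (pulses (signal_comp (shift_arr x g) (shift_arr x f)) ! k) u"
    if "k < length (src (signal_comp (shift_arr x g) (shift_arr x f)))" for k u
    using that F(3,4) F(6)[of k] G(3,4) G(6)[of "perm f k"] len
    by (auto simp: restrict_def less_diff_eq diff_less_eq le_diff_eq)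
qed (use assms in auto)

lemma shift_tensor:
  "shift_arr x (signal_tensor f g) = signal_tensor (shift_arr x f) (shift_arr x g)"
  by (rule signal.equality) (auto simp: shift_arr_def)

lemma shift_symmetry:
  "shift_arr x (signal_symmetry X Y) = signal_symmetry (shift_obj x X) (shift_obj x Y)"
  by (rule signal.equality) (auto simp: list_eq_iff_nth_eq)

lemma shift_arr_0 [simp]: "shift_arr 0 f = f"
  by (rule signal.equality) (auto simp: shift_arr_def)

lemma shift_shift_arr [simp]: "shift_arr x (shift_arr y f) = shift_arr (x + y) f"
  by (rule signal.equality) (auto simp: shift_arr_def algebra_simps)

definition shift_endofunctor :: "real \<Rightarrow> ('c sobj, 'c signal) endofunctor" where
  "shift_endofunctor x =
     \<lparr>fobj = shift_obj x, farr = shift_arr x, funit = signal_id [],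
      fmult = (\<lambda>X Y. signal_id (shift_obj x (X @ Y)))\<rparr>"

lemma shift_endofunctor_sel [simp]:
  "fobj (shift_endofunctor x) = shift_obj x" "farr (shift_endofunctor x) = shift_arr x"
  "funit (shift_endofunctor x) = signal_id []"
  "fmult (shift_endofunctor x) = (\<lambda>X Y. signal_id (shift_obj x (X @ Y)))"
  by (simp_all add: shift_endofunctor_def)

theorem symmetric_monoidal_endofunctor_shift:
  "symmetric_monoidal_endofunctor (signals C) (shift_endofunctor x)"
proof -
  interpret symmetric_monoidal_category "signals C"
    by (rule symmetric_monoidal_category_signals)
  show ?thesis
    by unfold_locales (auto simp: comp_id_left[of C] comp_id_right[of C] shift_comp[of C] shift_tensor
        shift_symmetry)
qed

text \<open>Identities are well typed as \<open>\<epsilon>\<close> and \<open>\<mu>\<close> because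
  shifts by \<open>0\<close> and by sums are strict. The coherence laws then compare composites of
  identities, up to associativity of addition.\<close>

theorem real_shift_action_signals:
  "real_shift_action (signals C) shift_endofunctor signal_id
     (\<lambda>x y X. signal_id (shift_obj (x + y) X))"
  by (intro real_shift_action.intro real_shift_action_axioms.intro
      symmetric_monoidal_category_signals symmetric_monoidal_endofunctor_shift)
    (auto simp: monoidal_natural_iso_def id_endofunctor_def comp_endofunctor_def add.assoc
      comp_id_left[of C] comp_id_right[of C])

section \<open>Delays and the assembled model\<close>

lemma signal_delay_in_hom:
  assumes "X \<in> lists (UNIV \<times> C)" "x \<ge> 0"
  shows "signal_delay x X \<in> hom (signals C) (shift_obj (- x) X) X"
proof -
  have "is_signal C (signal_delay x X)"
    \<comment> \<open>The hypothesis \<open>x \<ge> 0\<close> supplies the time inequality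
      \<open>t - x \<le> t\<close> at each position.\<close>
    by (rule is_signalI)
      (use assms in \<open>auto simp: signal_delay_def case_prod_beta permutes_id\<close>)
  then show ?thesis
    by (simp add: signal_delay_def)
qed

text \<open>Delays range over \<open>{0..}\<close> because of \<open>no_negative_delay\<close>. Only
  coherence data is quantified existentially; the action of the shifts on objects and arrows and the
  delays are prescribed.\<close>

theorem proposition11:
  fixes Q :: "'q set" and G :: "'g set" and C :: "'c set"
    and dur :: "'g \<Rightarrow> real" and qubits :: "'g \<Rightarrow> 'q list"
    and X :: "'q \<Rightarrow> (real \<times> 'c) list" and f :: "'g \<Rightarrow> 'c signal"
  assumes "\<And>g. g \<in> G \<Longrightarrow> dur g \<ge> 0"
    and "\<And>g. g \<in> G \<Longrightarrow> distinct (qubits g)"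
    and "\<And>g. g \<in> G \<Longrightarrow> set (qubits g) \<subseteq> Q"
    and "\<And>q. q \<in> Q \<Longrightarrow> X q \<in> Obj (signals C)"
    and "\<And>g. g \<in> G \<Longrightarrow> f g \<in> hom (signals C)
           (shift_obj (- dur g) (tensor_list (signals C) (map X (qubits g))))
           (tensor_list (signals C) (map X (qubits g)))"
  shows "\<exists>\<iota> \<nu> \<epsilon> \<mu>. categorical_model (signals C) Q G dur qubits {0..} X f
           (\<lambda>x. \<lparr>fobj = shift_obj x, farr = shift_arr x, funit = \<iota> x, fmult = \<nu> x\<rparr>) \<epsilon> \<mu>
           (\<lambda>x q. signal_delay x (X q))"
proof -
  interpret real_shift_action "signals C" shift_endofunctor signal_id
      "\<lambda>x y X. signal_id (shift_obj (x + y) X)"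
    by (rule real_shift_action_signals)
  have "categorical_model (signals C) Q G dur qubits {0..} X f shift_endofunctor signal_id
      (\<lambda>x y X. signal_id (shift_obj (x + y) X)) (\<lambda>x q. signal_delay x (X q))"
    \<comment> \<open>\<open>hom\<close> stays folded so that the gate hypothesis and
      \<open>signal_delay_in_hom\<close> apply as they stand.\<close>
    by unfold_locales (use assms(4,5) signal_delay_in_hom[of _ C] in \<open>auto simp del: in_hom_signals\<close>)
  then show ?thesis
    \<comment> \<open>Unfolding exposes the prescribed \<open>fobj\<close> and \<open>farr\<close>;
      the witnesses for \<open>\<iota>\<close> and \<open>\<nu>\<close> are the remaining two fields
      as functions of \<open>x\<close>.\<close>
    unfolding shift_endofunctor_def
    by (intro exI[of _ "\<lambda>_. signal_id []"] exI[of _ "\<lambda>x X Y. signal_id (shift_obj x (X @ Y))"]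
        exI[of _ signal_id] exI[of _ "\<lambda>x y X. signal_id (shift_obj (x + y) X)"])
qed

end
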